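(* Let $r\ge 0$ be an integer and let $a,b$ be indeterminates. For all integers $n\ge 0$, $$\mathcal{G}_{a,b}(n;r)=\sum_{i=0}^n \binom{n}{i}\,\mathcal{G}_{a,b}(n-i;0)\prod_{j=0}^{i-1}\bigl(aj+(a+b)r\bigr)$$ and $$\mathcal{G}_{a,b}(n+1;r)=r\sum_{i=0}^n \binom{n}{i}\, \mathcal{G}_{a,b}(n-i;r-1)\prod_{j=0}^{i}(aj+a+b)+\sum_{i=0}^n \binom{n}{i}\,\mathcal{G}_{a,b}(n-i;r)\prod_{j=0}^{i-1}(aj+a+b).$$
   Context: Write $[m]=\{1,\ldots,m\}$, $[0]=\varnothing$. A Lah distribution of $[m]$ into $\ell$ blocks is a partition of $[m]$ into $\ell$ non-empty, pairwise disjoint blocks in which the elements within each block are linearly ordered (the blocks themselves are not ordered). For integers $n,k,r$ with $0\le k\le n$ and $r\ge 0$, let $\mathcal{L}_r(n,k)$ be the set of Lah distributions of $[n+r]$ into $k+r$ blocks in which the elements of $[r]$ belong to distinct blocks. An element $i$ of a Lah distribution $\lambda$ is a record low if there is no element $j<i$ to the left of $i$ within its block. Let $rec^*(\lambda)$ be the number of record lows of $\lambda$ that are not the smallest element of their block, and let $nrec(\lambda)$ be the number of elements of the underlying set that are not record lows of $\lambda$. The generalized $r$-Lah number is the polynomial in indeterminates $a,b$ $$\mathcal{G}_{a,b}(n,k;r)=\sum_{\lambda\in\mathcal{L}_r(n,k)}a^{nrec(\lambda)}b^{rec^*(\lambda)},$$ with $\mathcal{G}_{a,b}(n,k;r)=0$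 unless $0\le k\le n$ and $r\ge 0$. The row sums are $\mathcal{G}_{a,b}(n;r)=\sum_{k=0}^n\mathcal{G}_{a,b}(n,k;r)$ for $n\ge 0$ (so $\mathcal{G}_{a,b}(n;-1)=0$). Empty sums are $0$ and empty products are $1$. *)

theory Defs
  imports "HOL-Computational_Algebra.Polynomial" "HOL-Library.Disjoint_Sets"
begin

text \<open>A Lah distribution of \<open>{1..m}\<close> into \<open>l\<close> blocks is a set of lists, each list being a block
  written out in its linear order. Injectivity of \<open>set\<close> says that different lists have different
  (hence disjoint) underlying blocks; finiteness is implied by the partition property.\<close>

definition lah_distribution :: "nat \<Rightarrow> nat \<Rightarrow> nat list set \<Rightarrow> bool" where
  "lah_distribution m l D \<longleftrightarrow>
     partition_on {1..m} (set ` D) \<and> inj_on set D \<and> (\<forall>xs\<in>D. distinct xs) \<and> card D = l"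

definition r_lah_distributions :: "nat \<Rightarrow> nat \<Rightarrow> nat \<Rightarrow> nat list set set" where
  "r_lah_distributions r n k =
     {D. lah_distribution (n + r) (k + r) D \<and>
         (\<forall>i\<in>{1..r}. \<forall>j\<in>{1..r}. i \<noteq> j \<longrightarrow> \<not> (\<exists>xs\<in>D. i \<in> set xs \<and> j \<in> set xs))}"

definition record_low :: "nat list \<Rightarrow> nat \<Rightarrow> bool" where
  "record_low xs i \<longleftrightarrow> (\<exists>p<length xs. xs ! p = i \<and> \<not> (\<exists>q<p. xs ! q < i))"

definition rec_star :: "nat list set \<Rightarrow> nat" where
  "rec_star D = card {i. \<exists>xs\<in>D. record_low xs i \<and> i \<noteq> Min (set xs)}"

definition nrec :: "nat list set \<Rightarrow> nat" where
  "nrec D = card {i. \<exists>xs\<in>D. i \<in> set xs \<and> \<not> record_low xs i}"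

text \<open>The ring \<open>\<int>[a, b]\<close> is realised as \<open>\<int>[a][b]\<close>, i.e. as \<open>int poly poly\<close>.\<close>

definition indet_a :: "int poly poly" where
  "indet_a = [:[:0, 1:]:]"

definition indet_b :: "int poly poly" where
  "indet_b = [:0, 1:]"

text \<open>The parameters are integers because the value at \<open>r = -1\<close>, which is \<open>0\<close>, is needed.\<close>

definition gen_r_lah :: "int \<Rightarrow> int \<Rightarrow> int \<Rightarrow> int poly poly" where
  "gen_r_lah n k r =
     (if 0 \<le> k \<and> k \<le> n \<and> 0 \<le> r
      then \<Sum>D\<in>r_lah_distributions (nat r) (nat n) (nat k). indet_a ^ nrec D * indet_b ^ rec_star D
      else 0)"

definition gen_r_lah_row :: "nat \<Rightarrow> int \<Rightarrow> int poly poly" where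
  "gen_r_lah_row n r = (\<Sum>k=0..n. gen_r_lah (int n) (int k) r)"

text \<open>The sums in \<open>gen_r_lah\<close> range over finite sets, so they are not silently \<open>0\<close>.\<close>

lemma finite_r_lah_distributions: "finite (r_lah_distributions r n k)"
proof (rule finite_subset)
  let ?L = "{xs. set xs \<subseteq> {1..n + r} \<and> length xs \<le> n + r}"
  show "finite (Pow ?L)"
    by (simp add: finite_lists_length_le)
  show "r_lah_distributions r n k \<subseteq> Pow ?L"
  proof (intro subsetI PowI)
    fix D xs
    assume D: "D \<in> r_lah_distributions r n k" and xs: "xs \<in> D"
    then have part: "partition_on {1..n + r} (set ` D)" and d: "distinct xs"
      by (auto simp: r_lah_distributions_def lah_distribution_def)
    have sub: "set xs \<subseteq> {1..n + r}"
      using partition_onD1[OF part] xs by auto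
    have "length xs = card (set xs)"
      using d by (simp add: distinct_card)
    also have "\<dots> \<le> n + r"
      using card_mono[OF _ sub] by simp
    finally show "xs \<in> ?L"
      using sub by simp
  qed
qed

end

theory Submission
  imports Defs
begin

text \<open>Inserting the largest element \<open>n + r + 1\<close> into a Lah distribution creates a new block (weight
  \<open>1\<close>), or puts it in front of one of the \<open>k + r\<close> blocks (a record low that is not the minimum, weight
  \<open>b\<close>), or right after one of the \<open>n + r\<close> elements (not a record low, weight \<open>a\<close>). Hence
  \<open>G(n+1,k;r) = G(n,k-1;r) + (an + bk + (a+b)r) G(n,k;r)\<close>. If \<open>f\<close> satisfies such a recurrence with
  constant term \<open>u\<close> and \<open>P(i+1) = (ai + v) P(i)\<close>, then the binomial convolution of \<open>f\<close> and \<open>P\<close>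
  satisfies it with constant term \<open>u + v\<close>. So both identities already hold for each fixed \<open>k\<close> (with
  \<open>k - 1\<close> in place of \<open>k\<close> in the last sum of the second one): the two sides obey the same recurrence
  and agree at \<open>n = 0\<close>. Summing over \<open>k\<close> gives the theorem.\<close>

section \<open>Record lows under insertion of a maximum\<close>

lemma record_low_Nil [simp]: "\<not> record_low [] i"
  by (simp add: record_low_def)

lemma record_low_Cons: "record_low (x # xs) i \<longleftrightarrow> x = i \<or> record_low xs i \<and> \<not> x < i"
  by (auto simp: record_low_def Ex_less_Suc2 All_less_Suc2)

lemma record_low_append:
  "record_low (xs @ ys) i \<longleftrightarrow> record_low xs i \<or> record_low ys i \<and> (\<forall>x\<in>set xs. \<not> x < i)"
  by (induction xs) (auto simp: record_low_Cons)

lemma record_low_in_set: "record_low xs i \<Longrightarrow> i \<in> set xs"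
  by (auto simp: record_low_def)

text \<open>A strict maximum is never a smaller element to the left of another one, so it leaves the
  status of all others unchanged; it is itself a record low only if nothing precedes it.\<close>

lemma record_low_insert_max:
  assumes "\<forall>x\<in>set us \<union> set vs. x < m"
  shows "record_low (us @ m # vs) i \<longleftrightarrow> (if i = m then us = [] else record_low (us @ vs) i)"
proof (cases "i = m")
  case True
  have "set us = {} \<longleftrightarrow> (\<forall>x\<in>set us. \<not> x < m)"
    using assms by (metis UnI1 emptyE equals0I)
  then show ?thesis
    using True assms
    by (auto simp: record_low_append record_low_Cons dest: record_low_in_set)
next
  case False
  moreover have "i < m" if "record_low vs i"
    using assms record_low_in_set[OF that] by blast
  ultimately show ?thesis
    by (auto simp: record_low_append record_low_Cons)
qed

text \<open>The only element of a block is both a record low and the minimum, so neither statistic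
  counts it.\<close>

lemma nrec_insert_singleton: "nrec (insert [m] D) = nrec D"
  unfolding nrec_def by (rule arg_cong[of _ _ card]) (auto simp: record_low_Cons)

lemma rec_star_insert_singleton: "rec_star (insert [m] D) = rec_star D"
  unfolding rec_star_def by (rule arg_cong[of _ _ card]) (auto simp: record_low_Cons)

lemma nrec_insert_max:
  assumes less: "\<forall>x\<in>set us \<union> set vs. x < m" and m: "\<forall>xs\<in>E. m \<notin> set xs" and fin: "finite E"
  shows "nrec (insert (us @ m # vs) E) = nrec (insert (us @ vs) E) + (if us = [] then 0 else 1)"
proof -
  let ?N = "\<lambda>D. {i. \<exists>xs\<in>D. i \<in> set xs \<and> \<not> record_low xs i}"
  have eq: "?N (insert (us @ m # vs) E) = (if us = [] then {} else {m}) \<union> ?N (insert (us @ vs) E)"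
    using less by (auto simp: record_low_insert_max)
  have "?N (insert (us @ vs) E) \<subseteq> (\<Union>xs\<in>insert (us @ vs) E. set xs)"
    by auto
  then have "finite (?N (insert (us @ vs) E))"
    by (rule finite_subset) (use fin in auto)
  moreover have "m \<notin> ?N (insert (us @ vs) E)"
    using less m by auto
  ultimately show ?thesis
    unfolding nrec_def eq by auto
qed

text \<open>The old block is nonempty and its minimum lies below \<open>m\<close>, so the minimum
  survives the insertion. Hence \<open>m\<close> in front is a record low other than the minimum,
  and \<open>m\<close> elsewhere is no record low.\<close>

lemma rec_star_insert_max:
  assumes less: "\<forall>x\<in>set us \<union> set vs. x < m" and m: "\<forall>xs\<in>E. m \<notin> set xs" and fin: "finite E"
    and ne: "us @ vs \<noteq> []"
  shows "rec_star (insert (us @ m # vs) E) =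
    rec_star (insert (us @ vs) E) + (if us = [] then 1 else 0)"
proof -
  let ?N = "\<lambda>D. {i. \<exists>xs\<in>D. record_low xs i \<and> i \<noteq> Min (set xs)}"
  have min_lt: "Min (set (us @ vs)) < m"
    using less ne by (subst Min_less_iff) (auto simp: neq_Nil_conv)
  have "set (us @ m # vs) = insert m (set (us @ vs))"
    by auto
  then have min: "Min (set (us @ m # vs)) = Min (set (us @ vs))"
    using ne min_lt by (simp only: Min_insert List.finite_set set_empty) auto
  have rl: "record_low (us @ m # vs) i \<and> i \<noteq> Min (set (us @ m # vs)) \<longleftrightarrow>
      (i = m \<and> us = []) \<or> (record_low (us @ vs) i \<and> i \<noteq> Min (set (us @ vs)))" for i
    using less record_low_in_set[of "us @ vs" m] min_lt
    unfolding record_low_insert_max[OF less] min by (cases "i = m") auto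
  have eq: "?N (insert (us @ m # vs) E) = (if us = [] then {m} else {}) \<union> ?N (insert (us @ vs) E)"
    unfolding bex_simps rl by auto
  have "?N (insert (us @ vs) E) \<subseteq> (\<Union>xs\<in>insert (us @ vs) E. set xs)"
    by (auto dest: record_low_in_set)
  then have "finite (?N (insert (us @ vs) E))"
    by (rule finite_subset) (use fin in auto)
  moreover have "m \<notin> ?N (insert (us @ vs) E)"
    using less m by (auto dest!: record_low_in_set)
  ultimately show ?thesis
    unfolding rec_star_def eq by auto
qed

section \<open>Insertion of a maximum into a Lah distribution\<close>

text \<open>Elementwise form of the conditions, over an arbitrary ground set so that
  \<open>m\<close> can be added and deleted, with the number of blocks kept apart. The last clause
  puts no lower bound on \<open>i\<close> and \<open>j\<close>, which is harmless for
  \<open>{1..n + r}\<close> since its elements are positive.\<close>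

definition lah_blocks :: "nat set \<Rightarrow> nat \<Rightarrow> nat list set \<Rightarrow> bool" where
  "lah_blocks S r D \<longleftrightarrow> (\<Union>xs\<in>D. set xs) = S \<and> (\<forall>xs\<in>D. xs \<noteq> [] \<and> distinct xs) \<and>
     (\<forall>xs\<in>D. \<forall>ys\<in>D. xs \<noteq> ys \<longrightarrow> set xs \<inter> set ys = {}) \<and>
     (\<forall>xs\<in>D. \<forall>i\<in>set xs. \<forall>j\<in>set xs. i \<le> r \<longrightarrow> j \<le> r \<longrightarrow> i = j)"

lemma r_lah_distributions_iff:
  "D \<in> r_lah_distributions r n k \<longleftrightarrow> lah_blocks {1..n + r} r D \<and> card D = k + r"
proof
  assume D: "D \<in> r_lah_distributions r n k"
  then have part: "partition_on {1..n + r} (set ` D)" and inj: "inj_on set D"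
    and dist: "\<forall>xs\<in>D. distinct xs" and card: "card D = k + r"
    and sep: "\<forall>i\<in>{1..r}. \<forall>j\<in>{1..r}. i \<noteq> j \<longrightarrow> \<not> (\<exists>xs\<in>D. i \<in> set xs \<and> j \<in> set xs)"
    by (auto simp: r_lah_distributions_def lah_distribution_def)
  have un: "(\<Union>xs\<in>D. set xs) = {1..n + r}"
    using partition_onD1[OF part] by simp
  have "set xs \<inter> set ys = {}" if "xs \<in> D" "ys \<in> D" "xs \<noteq> ys" for xs ys
  proof -
    have "set xs \<noteq> set ys"
      using inj that by (auto dest: inj_onD)
    then show ?thesis
      using partition_onD2[OF part] that by (auto simp: disjoint_def)
  qed
  moreover have "xs \<noteq> []" if "xs \<in> D" for xs
    using partition_onD3[OF part] that by auto
  moreover have "i = j" if "xs \<in> D" "i \<in> set xs" "j \<in> set xs" "i \<le> r" "j \<le> r" for xs i j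
  proof -
    have "i \<ge> 1" "j \<ge> 1"
      using un that by auto
    then have "i \<in> {1..r}" "j \<in> {1..r}"
      using that by auto
    then show ?thesis
      using sep that by blast
  qed
  ultimately show "lah_blocks {1..n + r} r D \<and> card D = k + r"
    using un dist card unfolding lah_blocks_def by blast
next
  assume *: "lah_blocks {1..n + r} r D \<and> card D = k + r"
  \<comment> \<open>Two different lists with the same elements would be disjoint, hence empty, but
    blocks are nonempty.\<close>
  then have "inj_on set D"
    by (auto simp: lah_blocks_def inj_on_def) (metis Int_absorb set_empty)
  moreover have "\<forall>xs\<in>D. \<forall>ys\<in>D. xs \<noteq> ys \<longrightarrow> set xs \<inter> set ys = {}"
    using * by (simp add: lah_blocks_def)
  then have "disjoint (set ` D)"
    unfolding disjoint_def by (simp add: Ball_image_comp) metis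
  then have "partition_on {1..n + r} (set ` D)"
    using * by (auto simp: lah_blocks_def partition_on_def)
  ultimately show "D \<in> r_lah_distributions r n k"
    using * unfolding r_lah_distributions_def lah_distribution_def lah_blocks_def by auto
qed

section \<open>Counting blocks and elements\<close>

lemma finite_lah_blocks:
  assumes "lah_blocks S r D" "finite S"
  shows "finite D"
proof -
  have "inj_on set D"
    using assms by (auto simp: lah_blocks_def inj_on_def) (metis Int_absorb set_empty)
  moreover have "set ` D \<subseteq> Pow S"
    using assms by (auto simp: lah_blocks_def)
  ultimately show ?thesis
    using assms(2) by (meson finite_Pow_iff finite_imageD finite_subset)
qed

lemma sum_length_lah_blocks:
  assumes "lah_blocks S r D" "finite S"
  shows "(\<Sum>xs\<in>D. length xs) = card S"
proof -
  have "(\<Sum>xs\<in>D. length xs) = (\<Sum>xs\<in>D. card (set xs))"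
    using assms by (intro sum.cong) (auto simp: lah_blocks_def distinct_card)
  also have "\<dots> = card (\<Union>xs\<in>D. set xs)"
    using assms finite_lah_blocks[OF assms]
    by (intro card_UN_disjoint[symmetric]) (auto simp: lah_blocks_def)
  finally show ?thesis
    using assms by (simp add: lah_blocks_def)
qed

lemma card_lah_blocks_le:
  assumes "lah_blocks S r D" "finite S"
  shows "card D \<le> card S"
proof -
  have "card D = (\<Sum>xs\<in>D. 1)"
    by simp
  also have "\<dots> \<le> (\<Sum>xs\<in>D. length xs)"
    using assms by (intro sum_mono) (auto simp: lah_blocks_def Suc_le_eq)
  finally show ?thesis
    using sum_length_lah_blocks[OF assms] by simp
qed

text \<open>Choosing for every \<open>i\<close> in \<open>{1..r}\<close> a block that contains it is
  injective by the separation clause.\<close>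

lemma le_card_lah_blocks:
  assumes D: "lah_blocks S r D" "finite S" and sub: "{1..r} \<subseteq> S"
  shows "r \<le> card D"
proof -
  have "\<forall>i\<in>{1..r}. \<exists>xs. xs \<in> D \<and> i \<in> set xs"
    using D sub by (auto simp: lah_blocks_def)
  from bchoice[OF this] obtain f where f: "\<And>i. i \<in> {1..r} \<Longrightarrow> f i \<in> D \<and> i \<in> set (f i)"
    by blast
  have "inj_on f {1..r}"
  proof (rule inj_onI)
    fix i j assume ij: "i \<in> {1..r}" "j \<in> {1..r}" "f i = f j"
    then have "f i \<in> D" "i \<in> set (f i)" "j \<in> set (f i)" "i \<le> r" "j \<le> r"
      using f[of i] f[of j] by auto
    then show "i = j"
      using D(1) unfolding lah_blocks_def by blast
  qed
  then have "card {1..r} \<le> card D"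
    using f finite_lah_blocks[OF D] by (intro card_inj_on_le) auto
  then show ?thesis
    by simp
qed

lemma lah_blocks_notin: "lah_blocks S r D \<Longrightarrow> m \<notin> S \<Longrightarrow> xs \<in> D \<Longrightarrow> m \<notin> set xs"
  by (auto simp: lah_blocks_def)

lemma lah_blocks_unique:
  "lah_blocks S r D \<Longrightarrow> xs \<in> D \<Longrightarrow> ys \<in> D \<Longrightarrow> m \<in> set xs \<Longrightarrow> m \<in> set ys \<Longrightarrow> xs = ys"
  unfolding lah_blocks_def by blast

section \<open>Adding and deleting the largest element\<close>

lemma lah_blocks_insert_singleton:
  assumes "\<forall>xs\<in>D. m \<notin> set xs" "m \<notin> S"
  shows "lah_blocks (insert m S) r (insert [m] D) \<longleftrightarrow> lah_blocks S r D"
proof -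
  have "(\<Union>xs\<in>insert [m] D. set xs) = insert m S \<longleftrightarrow> (\<Union>xs\<in>D. set xs) = S"
    using assms by (auto simp: set_eq_iff)
  moreover have "xs \<noteq> [m] \<and> [m] \<noteq> xs" if "xs \<in> D" for xs
    using assms(1) that by auto
  ultimately show ?thesis
    using assms unfolding lah_blocks_def by auto
qed

text \<open>Since \<open>r < m\<close>, the separation clause ignores the new element; since
  \<open>us @ vs\<close> is nonempty, deleting \<open>m\<close> leaves no empty block. Being an
  equivalence, this serves insertion and deletion alike.\<close>

lemma lah_blocks_insert_max:
  assumes E: "\<forall>xs\<in>E. m \<notin> set xs" "us @ vs \<notin> E" and m: "m \<notin> S" "m \<notin> set us" "m \<notin> set vs" "r < m"
    and ne: "us @ vs \<noteq> []"
  shows "lah_blocks (insert m S) r (insert (us @ m # vs) E) \<longleftrightarrow> lah_blocks S r (insert (us @ vs) E)"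
proof -
  define xs ys where "xs = us @ vs" and "ys = us @ m # vs"
  have ys: "set ys = insert m (set xs)" "distinct ys \<longleftrightarrow> distinct xs" "ys \<noteq> []"
    and xs: "xs \<noteq> []" "xs \<notin> E" "m \<notin> set xs"
    using E m ne by (auto simp: xs_def ys_def)
  have ysE: "ys \<notin> E"
    using E(1) ys by auto
  have "(\<Union>zs\<in>insert ys E. set zs) = insert m S \<longleftrightarrow> (\<Union>zs\<in>insert xs E. set zs) = S"
    using E(1) m(1) ys xs by (auto simp: set_eq_iff)
  moreover have "(\<forall>ws\<in>insert ys E. \<forall>zs\<in>insert ys E. ws \<noteq> zs \<longrightarrow> set ws \<inter> set zs = {}) \<longleftrightarrow>
      (\<forall>ws\<in>insert xs E. \<forall>zs\<in>insert xs E. ws \<noteq> zs \<longrightarrow> set ws \<inter> set zs = {})"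
    using E(1) ys(1) xs ysE by fastforce
  moreover have "(\<forall>zs\<in>insert ys E. \<forall>i\<in>set zs. \<forall>j\<in>set zs. i \<le> r \<longrightarrow> j \<le> r \<longrightarrow> i = j) \<longleftrightarrow>
      (\<forall>zs\<in>insert xs E. \<forall>i\<in>set zs. \<forall>j\<in>set zs. i \<le> r \<longrightarrow> j \<le> r \<longrightarrow> i = j)"
    using m(4) ys(1) by auto
  ultimately show ?thesis
    using ys xs unfolding lah_blocks_def xs_def[symmetric] ys_def[symmetric] by auto
qed

definition insert_at :: "'a \<Rightarrow> nat \<Rightarrow> 'a list \<Rightarrow> 'a list" where
  "insert_at m p xs = take p xs @ m # drop p xs"

lemma set_insert_at: "set (insert_at m p xs) = insert m (set xs)"
proof -
  have "set (insert_at m p xs) = insert m (set (take p xs @ drop p xs))"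
    unfolding insert_at_def set_append by auto
  then show ?thesis
    by (simp only: append_take_drop_id)
qed

lemma insert_at_neq: "insert_at m p xs \<noteq> xs"
  by (rule notI, drule arg_cong[of _ _ length]) (simp add: insert_at_def)

text \<open>The triple consists of a distribution, one of its blocks and a position, so that a
  nested \<open>SIGMA\<close> describes all choices. Position \<open>0\<close> is the front of the
  block.\<close>

definition lah_insert :: "nat \<Rightarrow> nat list set \<times> nat list \<times> nat \<Rightarrow> nat list set" where
  "lah_insert m = (\<lambda>(D, xs, p). insert (insert_at m p xs) (D - {xs}))"

lemma bij_betw_insert_singleton:
  "bij_betw (insert [Suc (n + r)]) (r_lah_distributions r n k)
     {D \<in> r_lah_distributions r (Suc n) (Suc k). [Suc (n + r)] \<in> D}"
proof -
  let ?m = "Suc (n + r)"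
  have S: "{1..Suc n + r} = insert ?m {1..n + r}"
    by auto
  have fresh: "\<forall>xs\<in>D. ?m \<notin> set xs" if "lah_blocks {1..n + r} r D" for D
    using lah_blocks_notin[OF that, of ?m] by auto
  show ?thesis
  proof (rule bij_betwI[where g = "\<lambda>D. D - {[?m]}"])
    show "insert [?m] \<in> r_lah_distributions r n k \<rightarrow>
        {D \<in> r_lah_distributions r (Suc n) (Suc k). [?m] \<in> D}"
    proof
      fix D assume "D \<in> r_lah_distributions r n k"
      then have D: "lah_blocks {1..n + r} r D" "card D = k + r"
        by (auto simp: r_lah_distributions_iff)
      have "[?m] \<notin> D"
        using fresh[OF D(1)] by auto
      then have "card (insert [?m] D) = Suc k + r"
        using D(2) finite_lah_blocks[OF D(1)] by simp
      moreover have "lah_blocks {1..Suc n + r} r (insert [?m] D)"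
        unfolding S using lah_blocks_insert_singleton[of D ?m "{1..n + r}" r] fresh[OF D(1)] D(1)
        by simp
      ultimately show "insert [?m] D \<in> {D \<in> r_lah_distributions r (Suc n) (Suc k). [?m] \<in> D}"
        by (auto simp: r_lah_distributions_iff)
    qed
    show "(\<lambda>D. D - {[?m]}) \<in> {D \<in> r_lah_distributions r (Suc n) (Suc k). [?m] \<in> D} \<rightarrow>
        r_lah_distributions r n k"
    proof
      fix D assume "D \<in> {D \<in> r_lah_distributions r (Suc n) (Suc k). [?m] \<in> D}"
      then have D: "lah_blocks {1..Suc n + r} r D" "card D = Suc k + r" and mD: "[?m] \<in> D"
        by (auto simp: r_lah_distributions_iff)
      have "\<forall>xs\<in>D - {[?m]}. ?m \<notin> set xs"
        using lah_blocks_unique[OF D(1) _ mD, of _ ?m] by auto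
      then have "lah_blocks {1..n + r} r (D - {[?m]})"
        using lah_blocks_insert_singleton[of "D - {[?m]}" ?m "{1..n + r}" r] D(1) mD
        unfolding S by (simp add: insert_absorb)
      moreover have "card (D - {[?m]}) = k + r"
        using D(2) mD finite_lah_blocks[OF D(1)] by simp
      ultimately show "D - {[?m]} \<in> r_lah_distributions r n k"
        by (simp add: r_lah_distributions_iff)
    qed
    show "insert [?m] D - {[?m]} = D" if "D \<in> r_lah_distributions r n k" for D
      using that fresh[of D] by (auto simp: r_lah_distributions_iff)
    show "insert [?m] (D - {[?m]}) = D"
      if "D \<in> {D \<in> r_lah_distributions r (Suc n) (Suc k). [?m] \<in> D}" for D
      using that by auto
  qed
qed

text \<open>Deleting the block \<open>[m]\<close> would leave \<open>r - 1\<close> blocks, too few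
  to separate the elements of \<open>{1..r}\<close>.\<close>

lemma singleton_notin_r_lah_distributions_0:
  assumes "D \<in> r_lah_distributions r (Suc n) 0"
  shows "[Suc (n + r)] \<notin> D"
proof
  let ?m = "Suc (n + r)"
  assume mD: "[?m] \<in> D"
  have D: "lah_blocks {1..Suc n + r} r D" "card D = r"
    using assms by (auto simp: r_lah_distributions_iff)
  have S: "{1..Suc n + r} = insert ?m {1..n + r}"
    by auto
  have "\<forall>xs\<in>D - {[?m]}. ?m \<notin> set xs"
    using lah_blocks_unique[OF D(1) _ mD, of _ ?m] by auto
  then have "lah_blocks {1..n + r} r (D - {[?m]})"
    using lah_blocks_insert_singleton[of "D - {[?m]}" ?m "{1..n + r}" r] D(1) mD
    unfolding S by (simp add: insert_absorb)
  then have "r \<le> card (D - {[?m]})"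
    by (rule le_card_lah_blocks) auto
  also have "\<dots> < card D"
    by (intro card_Diff1_less finite_lah_blocks[OF D(1)] mD) simp
  finally show False
    using D(2) by simp
qed

text \<open>Removing \<open>m\<close> recovers the list, and the length of the part before
  \<open>m\<close> recovers the position.\<close>

lemma insert_at_inject:
  assumes "insert_at m p xs = insert_at m q ys" "m \<notin> set xs" "m \<notin> set ys"
    "p \<le> length xs" "q \<le> length ys"
  shows "xs = ys \<and> p = q"
proof -
  have "removeAll m (insert_at m p xs) = xs" "removeAll m (insert_at m q ys) = ys"
    using assms(2,3) unfolding insert_at_def
    by (metis append_take_drop_id removeAll.simps(2) removeAll_append removeAll_id)+
  moreover have "takeWhile (\<lambda>x. x \<noteq> m) (insert_at m p xs) = take p xs"
    "takeWhile (\<lambda>x. x \<noteq> m) (insert_at m q ys) = take q ys"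
    using assms(2,3) unfolding insert_at_def
    by (subst takeWhile_append2; auto dest: in_set_takeD)+
  ultimately show ?thesis
    using assms(1,4,5) by (metis length_take min.absorb2)
qed

text \<open>If the maximum is not alone in its block, deleting it keeps the number of blocks, and
  its former block and position are the remaining data of the triple.\<close>

lemma bij_betw_lah_insert:
  "bij_betw (lah_insert (Suc (n + r)))
     (SIGMA D : r_lah_distributions r n k. SIGMA xs : D. {..length xs})
     {D \<in> r_lah_distributions r (Suc n) k. [Suc (n + r)] \<notin> D}"
proof -
  let ?m = "Suc (n + r)"
  let ?A = "SIGMA D : r_lah_distributions r n k. SIGMA xs : D. {..length xs}"
  let ?B = "{D \<in> r_lah_distributions r (Suc n) k. [?m] \<notin> D}"
  have S: "{1..Suc n + r} = insert ?m {1..n + r}"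
    by auto
  have fresh: "?m \<notin> set xs" if "D \<in> r_lah_distributions r n k" "xs \<in> D" for D xs
    using lah_blocks_notin[of "{1..n + r}" r D ?m xs] that by (simp add: r_lah_distributions_iff)
  have ins: "lah_insert ?m (D, xs, p) \<in> ?B" if A: "(D, xs, p) \<in> ?A" for D xs p
  proof -
    have D: "lah_blocks {1..n + r} r D" "card D = k + r" and xs: "xs \<in> D"
      using A by (auto simp: r_lah_distributions_iff)
    have m: "\<forall>ys\<in>D. ?m \<notin> set ys"
      using fresh A by auto
    have ne: "xs \<noteq> []"
      using D(1) xs by (auto simp: lah_blocks_def)
    have "lah_blocks (insert ?m {1..n + r}) r (insert (take p xs @ ?m # drop p xs) (D - {xs}))"
      using D(1) xs m ne by (subst lah_blocks_insert_max)
        (auto simp: insert_absorb dest: in_set_takeD in_set_dropD)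
    \<comment> \<open>The modified block is new because it contains \<open>m\<close>, so one block
      is exchanged for another and the cardinality is preserved.\<close>
    moreover have "take p xs @ ?m # drop p xs \<notin> D - {xs}"
      using m by auto
    then have "card (insert (take p xs @ ?m # drop p xs) (D - {xs})) = card D"
      using finite_lah_blocks[OF D(1)] xs by (simp add: card_Suc_Diff1 del: card_Diff_insert)
    moreover have "take p xs @ ?m # drop p xs \<noteq> [?m]"
      using ne by (auto simp: append_eq_Cons_conv)
    moreover have "[?m] \<notin> D"
      using m by auto
    ultimately show ?thesis
      using D(2) unfolding r_lah_distributions_iff S lah_insert_def insert_at_def by simp
  qed
  show ?thesis
  proof (rule bij_betw_imageI)
    show "inj_on (lah_insert ?m) ?A"
    proof (rule inj_onI)
      fix s t
      assume st: "s \<in> ?A" "t \<in> ?A" "lah_insert ?m s = lah_insert ?m t"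
      obtain D xs p E ys q where s: "s = (D, xs, p)" and t: "t = (E, ys, q)"
        by (metis prod_cases3)
      have D: "D \<in> r_lah_distributions r n k" "xs \<in> D" "p \<le> length xs"
        and E: "E \<in> r_lah_distributions r n k" "ys \<in> E" "q \<le> length ys"
        and eq: "lah_insert ?m (D, xs, p) = lah_insert ?m (E, ys, q)"
        using st by (auto simp: s t)
      \<comment> \<open>The image falls apart into the one block with \<open>m\<close>, which
        determines \<open>xs\<close> and \<open>p\<close>, and the blocks without \<open>m\<close>,
        which are \<open>D - {xs}\<close>.\<close>
      have max_block: "{zs \<in> lah_insert ?m (D, xs, p). ?m \<in> set zs} = {insert_at ?m p xs}"
        if "D \<in> r_lah_distributions r n k" for D xs p
        using fresh[OF that] insert_at_neq[of ?m p xs]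
        by (auto simp: lah_insert_def set_insert_at)
      have rest: "{zs \<in> lah_insert ?m (D, xs, p). ?m \<notin> set zs} = D - {xs}"
        if "D \<in> r_lah_distributions r n k" for D xs p
        using fresh[OF that] insert_at_neq[of ?m p xs]
        by (auto simp: lah_insert_def set_insert_at)
      have "insert_at ?m p xs = insert_at ?m q ys"
        using max_block[OF D(1), of xs p] max_block[OF E(1), of ys q] eq by simp
      then have "xs = ys \<and> p = q"
        by (rule insert_at_inject) (use D E fresh in auto)
      moreover have "D - {xs} = E - {ys}"
        using rest[OF D(1), of xs p] rest[OF E(1), of ys q] eq by simp
      ultimately show "s = t"
        using D(2) E(2) by (auto simp: s t)
    qed
    show "lah_insert ?m ` ?A = ?B"
    proof
      show "lah_insert ?m ` ?A \<subseteq> ?B"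
        using ins by auto
      show "?B \<subseteq> lah_insert ?m ` ?A"
      proof
        fix D' assume "D' \<in> ?B"
        then have D': "lah_blocks (insert ?m {1..n + r}) r D'" "card D' = k + r" "[?m] \<notin> D'"
          unfolding r_lah_distributions_iff S by simp_all
        then obtain ys where ys: "ys \<in> D'" "?m \<in> set ys"
          unfolding lah_blocks_def by (metis UN_E insertI1)
        then obtain us vs where split: "ys = us @ ?m # vs"
          by (meson split_list)
        have dist: "distinct ys"
          using D'(1) ys by (auto simp: lah_blocks_def)
        have ne: "us @ vs \<noteq> []"
          using ys D'(3) split by auto
        let ?E = "D' - {ys}"
        have disj: "set zs \<inter> set ys = {}" if "zs \<in> ?E" for zs
          using D'(1) that ys unfolding lah_blocks_def by blast
        have E: "\<forall>zs\<in>?E. ?m \<notin> set zs"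
          using disj ys by blast
        \<comment> \<open>A nonempty list of elements of \<open>ys\<close> cannot be one of the
          other blocks, as these are disjoint from \<open>ys\<close>.\<close>
        have notin: "us @ vs \<notin> ?E"
          using disj[of "us @ vs"] ne split by (auto simp: neq_Nil_conv)
        have "lah_blocks {1..n + r} r (insert (us @ vs) ?E)"
          using lah_blocks_insert_max[of ?E ?m us vs "{1..n + r}" r] E notin ne dist D'(1) ys(1)
          by (auto simp: split insert_absorb)
        moreover have "card (insert (us @ vs) ?E) = k + r"
          using notin finite_lah_blocks[OF D'(1)] D'(2) ys(1)
          by (simp add: card_Suc_Diff1 del: card_Diff_insert)
        ultimately have "(insert (us @ vs) ?E, us @ vs, length us) \<in> ?A"
          by (auto simp: r_lah_distributions_iff)
        moreover have "lah_insert ?m (insert (us @ vs) ?E, us @ vs, length us) = D'"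
          using notin ys(1) by (auto simp: lah_insert_def insert_at_def split)
        ultimately show "D' \<in> lah_insert ?m ` ?A"
          by (metis imageI)
      qed
    qed
  qed
qed

section \<open>The recurrence for the generalized r-Lah numbers\<close>

definition lah_weight :: "nat list set \<Rightarrow> int poly poly" where
  "lah_weight D = indet_a ^ nrec D * indet_b ^ rec_star D"

lemma lah_weight_insert_singleton: "lah_weight (insert [m] D) = lah_weight D"
  by (simp add: lah_weight_def nrec_insert_singleton rec_star_insert_singleton)

lemma lah_weight_lah_insert:
  assumes D: "D \<in> r_lah_distributions r n k" and xs: "xs \<in> D" and p: "p \<le> length xs"
  shows "lah_weight (lah_insert (Suc (n + r)) (D, xs, p)) =
    (if p = 0 then indet_b else indet_a) * lah_weight D"
proof -
  let ?m = "Suc (n + r)" and ?us = "take p xs" and ?vs = "drop p xs" and ?E = "D - {xs}"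
  have D': "lah_blocks {1..n + r} r D"
    using D by (simp add: r_lah_distributions_iff)
  have fin: "finite ?E"
    using finite_lah_blocks[OF D'] by simp
  have less: "\<forall>x\<in>set ?us \<union> set ?vs. x < ?m"
  proof -
    have "set xs \<subseteq> {1..n + r}"
      using D' xs by (auto simp: lah_blocks_def)
    then show ?thesis
      by (auto dest!: in_set_takeD in_set_dropD)
  qed
  have m: "\<forall>ys\<in>?E. ?m \<notin> set ys"
    using lah_blocks_notin[OF D', of ?m] by auto
  \<comment> \<open>For a nonempty block, \<open>take p xs\<close> is empty only at
    \<open>p = 0\<close>; this matches the case distinction of the insertion lemmas.\<close>
  have ne: "xs \<noteq> []"
    using D' xs by (auto simp: lah_blocks_def)
  have "insert (?us @ ?vs) ?E = D"
    using xs by auto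
  then show ?thesis
    using nrec_insert_max[OF less m fin] rec_star_insert_max[OF less m fin] ne
    by (simp add: lah_weight_def lah_insert_def insert_at_def)
qed

text \<open>The sum is split according to whether the maximum forms a block of its own, and each
  part is transported along its bijection.\<close>

lemma sum_lah_weight_Suc:
  "(\<Sum>D\<in>r_lah_distributions r (Suc n) k. lah_weight D) =
     (if k = 0 then 0 else \<Sum>D\<in>r_lah_distributions r n (k - 1). lah_weight D) +
     (indet_a * of_nat (n + r) + indet_b * of_nat (k + r)) *
       (\<Sum>D\<in>r_lah_distributions r n k. lah_weight D)"
proof -
  let ?m = "Suc (n + r)"
  let ?R = "r_lah_distributions r (Suc n) k"
  let ?A = "SIGMA D : r_lah_distributions r n k. SIGMA xs : D. {..length xs}"
  have fin: "finite D" if "D \<in> r_lah_distributions r n k" for D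
    using that finite_lah_blocks by (auto simp: r_lah_distributions_iff)
  \<comment> \<open>The case \<open>k = 0\<close> must be separate, since \<open>k - 1\<close> is
    truncated to \<open>0\<close> there.\<close>
  have new: "(\<Sum>D | D \<in> ?R \<and> [?m] \<in> D. lah_weight D) =
      (if k = 0 then 0 else \<Sum>D\<in>r_lah_distributions r n (k - 1). lah_weight D)"
  proof (cases k)
    case 0
    then have "{D. D \<in> ?R \<and> [?m] \<in> D} = {}"
      using singleton_notin_r_lah_distributions_0 by blast
    then show ?thesis
      using 0 by (simp only: sum.empty) simp
  next
    case (Suc k')
    then show ?thesis
      using sum.reindex_bij_betw[OF bij_betw_insert_singleton[of n r k'], of lah_weight]
      by (simp add: lah_weight_insert_singleton)
  qed
  have positions: "(\<Sum>xs\<in>D. \<Sum>p\<le>length xs. (if p = 0 then indet_b else indet_a) * lah_weight D) =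
      (indet_a * of_nat (n + r) + indet_b * of_nat (k + r)) * lah_weight D"
    if D: "D \<in> r_lah_distributions r n k" for D
  proof -
    have len: "(\<Sum>xs\<in>D. length xs) = n + r" and card: "card D = k + r"
      using D sum_length_lah_blocks[of "{1..n + r}" r D] by (auto simp: r_lah_distributions_iff)
    \<comment> \<open>A block of length \<open>l\<close> offers one front position and
      \<open>l\<close> positions behind an element. The block lengths add up to
      \<open>n + r\<close>.\<close>
    have "(\<Sum>p\<le>l. (if p = 0 then indet_b else indet_a) * lah_weight D) =
        (indet_b + indet_a * of_nat l) * lah_weight D" for l :: nat
      by (induction l) (auto simp: algebra_simps)
    then have "(\<Sum>xs\<in>D. \<Sum>p\<le>length xs. (if p = 0 then indet_b else indet_a) * lah_weight D) =
        (\<Sum>xs\<in>D. indet_b + indet_a * of_nat (length xs)) * lah_weight D"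
      by (simp add: sum_distrib_right)
    also have "(\<Sum>xs\<in>D. indet_b + indet_a * of_nat (length xs)) =
        indet_b * of_nat (card D) + indet_a * of_nat (\<Sum>xs\<in>D. length xs)"
      by (simp add: sum.distrib sum_distrib_left algebra_simps)
    finally show ?thesis
      unfolding len card by (simp only: add.commute)
  qed
  have "(\<Sum>D | D \<in> ?R \<and> [?m] \<notin> D. lah_weight D) = (\<Sum>t\<in>?A. lah_weight (lah_insert ?m t))"
    using sum.reindex_bij_betw[OF bij_betw_lah_insert[of n r k], of lah_weight] by simp
  also have "\<dots> = (\<Sum>(D, xs, p)\<in>?A. (if p = 0 then indet_b else indet_a) * lah_weight D)"
    by (intro sum.cong) (auto simp: lah_weight_lah_insert)
  also have "\<dots> = (\<Sum>D\<in>r_lah_distributions r n k. \<Sum>(xs, p)\<in>(SIGMA xs : D. {..length xs}).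
      (if p = 0 then indet_b else indet_a) * lah_weight D)"
    by (subst sum.Sigma) (auto simp: finite_r_lah_distributions fin)
  also have "\<dots> = (\<Sum>D\<in>r_lah_distributions r n k. \<Sum>xs\<in>D. \<Sum>p\<le>length xs.
      (if p = 0 then indet_b else indet_a) * lah_weight D)"
    by (intro sum.cong refl, subst sum.Sigma) (auto simp: fin)
  also have "\<dots> = (indet_a * of_nat (n + r) + indet_b * of_nat (k + r)) *
      (\<Sum>D\<in>r_lah_distributions r n k. lah_weight D)"
    by (simp only: positions sum_distrib_left cong: sum.cong)
  finally have old: "(\<Sum>D | D \<in> ?R \<and> [?m] \<notin> D. lah_weight D) = \<dots>" .
  have "(\<Sum>D\<in>?R. lah_weight D) =
      (\<Sum>D | D \<in> ?R \<and> [?m] \<in> D. lah_weight D) + (\<Sum>D | D \<in> ?R \<and> [?m] \<notin> D. lah_weight D)"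
    using sum.Int_Diff[OF finite_r_lah_distributions, of lah_weight r "Suc n" k "{D. [?m] \<in> D}"]
    by (simp add: Int_def set_diff_eq)
  then show ?thesis
    unfolding new old .
qed

section \<open>Boundary values and integer parameters\<close>

lemma r_lah_distributions_empty:
  assumes "n < k"
  shows "r_lah_distributions r n k = {}"
proof -
  have False if "D \<in> r_lah_distributions r n k" for D
    using that card_lah_blocks_le[of "{1..n + r}" r D] assms by (simp add: r_lah_distributions_iff)
  then show ?thesis
    by blast
qed

text \<open>When all elements are at most \<open>r\<close>, the separation clause forces every block
  to be a singleton.\<close>

lemma r_lah_distributions_0_0: "r_lah_distributions r 0 0 = {(\<lambda>i. [i]) ` {1..r}}"
proof (intro set_eqI iffI)
  fix D assume "D \<in> r_lah_distributions r 0 0"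
  then have D: "lah_blocks {1..r} r D"
    by (simp add: r_lah_distributions_iff)
  then have un: "(\<Union>xs\<in>D. set xs) = {1..r}"
    by (simp add: lah_blocks_def)
  have single: "xs = [hd xs]" if xs: "xs \<in> D" for xs
  proof (cases xs)
    case Nil
    then show ?thesis
      using D xs by (auto simp: lah_blocks_def)
  next
    case (Cons x ys)
    have "y = x" if "y \<in> set ys" for y
    proof -
      have "x \<in> set xs" "y \<in> set xs"
        using that Cons by auto
      moreover from this have "x \<le> r" "y \<le> r"
        using un xs by auto
      ultimately show ?thesis
        using D xs unfolding lah_blocks_def by blast
    qed
    moreover have "x \<notin> set ys"
      using D xs Cons by (auto simp: lah_blocks_def)
    ultimately show ?thesis
      using Cons by (cases ys) auto
  qed
  have "xs \<in> (\<lambda>i. [i]) ` {1..r}" if "xs \<in> D" for xs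
  proof -
    have "hd xs \<in> set xs"
      by (subst single[OF that]) simp
    then have "hd xs \<in> {1..r}"
      unfolding un[symmetric] using that by (rule UN_I[rotated])
    then show ?thesis
      using single[OF that] by (rule rev_image_eqI)
  qed
  moreover have "[i] \<in> D" if "i \<in> {1..r}" for i
  proof -
    have "i \<in> (\<Union>xs\<in>D. set xs)"
      using un that by simp
    then obtain xs where xs: "xs \<in> D" "i \<in> set xs"
      by (rule UN_E)
    obtain x where "xs = [x]"
      using single[OF xs(1)] by metis
    then show ?thesis
      using xs by simp
  qed
  ultimately have "D = (\<lambda>i. [i]) ` {1..r}"
    by (intro equalityI subsetI) auto
  then show "D \<in> {(\<lambda>i. [i]) ` {1..r}}"
    by simp
next
  fix D assume "D \<in> {(\<lambda>i. [i]) ` {1..r}}"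
  then have D: "D = (\<lambda>i. [i]) ` {1..r}"
    by simp
  have "card D = r"
    unfolding D by (subst card_image) (auto simp: inj_on_def)
  then show "D \<in> r_lah_distributions r 0 0"
    by (auto simp: r_lah_distributions_iff lah_blocks_def D)
qed

lemma lah_weight_singletons: "lah_weight ((\<lambda>i. [i]) ` S) = 1"
proof -
  have "nrec ((\<lambda>i. [i]) ` S) = 0" "rec_star ((\<lambda>i. [i]) ` S) = 0"
    unfolding nrec_def rec_star_def by (auto simp: record_low_Cons)
  then show ?thesis
    by (simp add: lah_weight_def)
qed

lemma gen_r_lah_eq_sum:
  "gen_r_lah (int n) (int k) (int r) = (\<Sum>D\<in>r_lah_distributions r n k. lah_weight D)"
  by (simp add: gen_r_lah_def lah_weight_def r_lah_distributions_empty)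

lemma gen_r_lah_eq_0: "k < 0 \<or> n < k \<or> r < 0 \<Longrightarrow> gen_r_lah n k r = 0"
  by (auto simp: gen_r_lah_def)

lemma gen_r_lah_0: "gen_r_lah 0 k r = (if k = 0 \<and> 0 \<le> r then 1 else 0)"
proof (cases "k = 0 \<and> 0 \<le> r")
  case True
  then show ?thesis
    using gen_r_lah_eq_sum[of 0 0 "nat r"]
    by (simp add: r_lah_distributions_0_0 lah_weight_singletons)
next
  case False
  then show ?thesis
    by (intro trans[OF gen_r_lah_eq_0]) auto
qed

text \<open>Stated for all integers \<open>k\<close> and \<open>r\<close>: at \<open>k = 0\<close>
  the term with \<open>k - 1\<close> is the default \<open>0\<close>, and for negative
  \<open>k\<close> or \<open>r\<close> both sides vanish. This lets \<open>k - 1\<close> and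
  \<open>r - 1\<close> be substituted freely later.\<close>

lemma gen_r_lah_Suc:
  "gen_r_lah (int (Suc n)) k r = gen_r_lah (int n) (k - 1) r +
     (indet_a * of_nat n + indet_b * of_int k + (indet_a + indet_b) * of_int r) *
       gen_r_lah (int n) k r"
proof (cases "0 \<le> k \<and> 0 \<le> r")
  case True
  then obtain l s where l: "k = int l" and s: "r = int s"
    by (metis nonneg_int_cases)
  have "gen_r_lah (int n) (k - 1) r =
      (if l = 0 then 0 else \<Sum>D\<in>r_lah_distributions s n (l - 1). lah_weight D)"
    using gen_r_lah_eq_sum[of n "l - 1" s] by (auto simp: l s gen_r_lah_eq_0 of_nat_diff)
  then show ?thesis
    unfolding l s gen_r_lah_eq_sum sum_lah_weight_Suc by (simp add: algebra_simps)
next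
  case False
  then show ?thesis
    by (auto simp: gen_r_lah_eq_0)
qed

section \<open>Binomial convolution of triangular recurrences\<close>

text \<open>Pascal's rule in the shape of the Leibniz rule: passing from \<open>n\<close> to
  \<open>n + 1\<close> raises either the second or the first index of \<open>h\<close>.\<close>

lemma sum_binomial_Suc:
  fixes h :: "nat \<Rightarrow> nat \<Rightarrow> 'a :: comm_semiring_1"
  shows "(\<Sum>i\<le>Suc n. of_nat (Suc n choose i) * h i (Suc n - i)) =
    (\<Sum>i\<le>n. of_nat (n choose i) * (h i (Suc (n - i)) + h (Suc i) (n - i)))"
proof -
  have "(\<Sum>i\<le>Suc n. of_nat (Suc n choose i) * h i (Suc n - i)) =
      h 0 (Suc n) + (\<Sum>i\<le>n. of_nat (n choose Suc i) * h (Suc i) (n - i)) +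
      (\<Sum>i\<le>n. of_nat (n choose i) * h (Suc i) (n - i))"
    by (subst sum.atMost_Suc_shift) (simp add: algebra_simps sum.distrib)
  also have "h 0 (Suc n) + (\<Sum>i\<le>n. of_nat (n choose Suc i) * h (Suc i) (n - i)) =
      (\<Sum>i\<le>Suc n. of_nat (n choose i) * h i (Suc n - i))"
    by (subst sum.atMost_Suc_shift) simp
  \<comment> \<open>The top term drops out because \<open>n choose Suc n\<close> is
    \<open>0\<close>.\<close>
  also have "\<dots> = (\<Sum>i\<le>n. of_nat (n choose i) * h i (Suc (n - i)))"
    by (simp add: binomial_eq_0) (intro sum.cong; simp add: Suc_diff_le)
  finally show ?thesis
    by (simp add: distrib_left sum.distrib)
qed

text \<open>For fixed \<open>k\<close> this corresponds to the product of exponential generating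
  functions.\<close>

definition binomial_conv :: "(nat \<Rightarrow> int \<Rightarrow> 'a) \<Rightarrow> (nat \<Rightarrow> 'a) \<Rightarrow> nat \<Rightarrow> int \<Rightarrow> 'a :: comm_ring_1" where
  "binomial_conv f P n k = (\<Sum>i\<le>n. of_nat (n choose i) * f (n - i) k * P i)"

text \<open>By the Leibniz rule the factors of the two recurrences add up, and
  \<open>a * (n - i) + a * i = a * n\<close> does not depend on \<open>i\<close>.\<close>

lemma binomial_conv_Suc:
  fixes a b u v :: "'a :: comm_ring_1"
  assumes f: "\<And>n k. f (Suc n) k = f n (k - 1) + (a * of_nat n + b * of_int k + u) * f n k"
    and P: "\<And>i. P (Suc i) = (a * of_nat i + v) * P i"
  shows "binomial_conv f P (Suc n) k =
    binomial_conv f P n (k - 1) + (a * of_nat n + b * of_int k + (u + v)) * binomial_conv f P n k"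
proof -
  have "binomial_conv f P (Suc n) k =
      (\<Sum>i\<le>n. of_nat (n choose i) * (f (Suc (n - i)) k * P i + f (n - i) k * P (Suc i)))"
    unfolding binomial_conv_def using sum_binomial_Suc[of n "\<lambda>i j. f j k * P i"]
    by (simp only: mult.assoc)
  also have "\<dots> = (\<Sum>i\<le>n. of_nat (n choose i) * f (n - i) (k - 1) * P i +
      (a * of_nat n + b * of_int k + (u + v)) * (of_nat (n choose i) * f (n - i) k * P i))"
  proof (rule sum.cong)
    fix i assume "i \<in> {..n}"
    then have n: "(of_nat n :: 'a) = of_nat (n - i) + of_nat i"
      by (simp flip: of_nat_add)
    show "of_nat (n choose i) * (f (Suc (n - i)) k * P i + f (n - i) k * P (Suc i)) =
        of_nat (n choose i) * f (n - i) (k - 1) * P i +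
        (a * of_nat n + b * of_int k + (u + v)) * (of_nat (n choose i) * f (n - i) k * P i)"
      unfolding f P n by (simp add: algebra_simps)
  qed simp
  finally show ?thesis
    by (simp add: binomial_conv_def sum.distrib sum_distrib_left)
qed

lemma sum_binomial_conv:
  "(\<Sum>k\<in>K. binomial_conv f P n (g k)) =
    (\<Sum>i\<le>n. of_nat (n choose i) * (\<Sum>k\<in>K. f (n - i) (g k)) * P i)"
  unfolding binomial_conv_def by (subst sum.swap) (simp add: sum_distrib_left sum_distrib_right)

section \<open>Row sums\<close>

lemma gen_r_lah_eq_conv:
  "gen_r_lah (int n) k (int r) =
    binomial_conv (\<lambda>n k. gen_r_lah (int n) k 0)
      (\<lambda>i. \<Prod>j<i. indet_a * of_nat j + (indet_a + indet_b) * of_nat r) n k"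
proof (induction n arbitrary: k)
  case 0
  then show ?case
    by (simp add: binomial_conv_def gen_r_lah_0)
next
  case (Suc n)
  \<comment> \<open>The recurrence at \<open>r = 0\<close> has constant term \<open>0\<close>, and
    each new factor of the product contributes \<open>(a + b) * r\<close>, the constant term for
    general \<open>r\<close>.\<close>
  show ?case
    by (subst binomial_conv_Suc[where a = indet_a and b = indet_b and u = 0 and
          v = "(indet_a + indet_b) * of_nat r"])
      (simp_all only: gen_r_lah_Suc prod.lessThan_Suc flip: Suc.IH, simp_all)
qed

lemma gen_r_lah_Suc_eq_conv:
  "gen_r_lah (int (Suc n)) k (int r) =
    of_nat r * binomial_conv (\<lambda>n k. gen_r_lah (int n) k (int r - 1))
      (\<lambda>i. \<Prod>j\<le>i. indet_a * of_nat j + indet_a + indet_b) n k +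
    binomial_conv (\<lambda>n k. gen_r_lah (int n) (k - 1) (int r))
      (\<lambda>i. \<Prod>j<i. indet_a * of_nat j + indet_a + indet_b) n k"
    (is "_ = of_nat r * binomial_conv ?f ?P n k + binomial_conv ?g ?Q n k")
proof (induction n arbitrary: k)
  case 0
  \<comment> \<open>At \<open>r = 0\<close> the value for \<open>r - 1 = -1\<close> is
    \<open>0\<close>. The term \<open>b * k\<close> does not contribute, since
    \<open>gen_r_lah 0 k r\<close> vanishes unless \<open>k = 0\<close>.\<close>
  show ?case
    unfolding gen_r_lah_Suc
    by (cases "r = 0") (simp_all add: binomial_conv_def gen_r_lah_0 algebra_simps)
next
  case (Suc n)
  \<comment> \<open>The product runs up to \<open>i\<close> inclusive, so its next factor is
    \<open>a * (i + 1) + a + b\<close>, whence the constant \<open>a + a + b\<close>. The total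
    constant is \<open>(a + b) * r + a\<close>, where the extra \<open>a\<close> accounts for the
    recurrence being used at \<open>Suc n\<close>.\<close>
  have f: "binomial_conv ?f ?P (Suc n) k = binomial_conv ?f ?P n (k - 1) +
      (indet_a * of_nat n + indet_b * of_int k + ((indet_a + indet_b) * of_int (int r - 1) +
        (indet_a + indet_a + indet_b))) * binomial_conv ?f ?P n k"
    by (rule binomial_conv_Suc) (simp_all only: gen_r_lah_Suc prod.atMost_Suc, simp_all add: algebra_simps)
  \<comment> \<open>Replacing \<open>k\<close> by \<open>k - 1\<close> turns \<open>b * k\<close>
    into \<open>b * k - b\<close>, whence the \<open>- b\<close>. The total is again
    \<open>(a + b) * r + a\<close>.\<close>
  have g: "binomial_conv ?g ?Q (Suc n) k = binomial_conv ?g ?Q n (k - 1) +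
      (indet_a * of_nat n + indet_b * of_int k + (((indet_a + indet_b) * of_nat r - indet_b) +
        (indet_a + indet_b))) * binomial_conv ?g ?Q n k"
    by (rule binomial_conv_Suc) (simp_all only: gen_r_lah_Suc prod.lessThan_Suc, simp_all add: algebra_simps)
  show ?case
    unfolding f g gen_r_lah_Suc[of "Suc n"] Suc.IH by (simp add: algebra_simps)
qed

text \<open>Terms with \<open>k > n\<close> vanish, so rows of different lengths can be summed over
  one common range.\<close>

lemma gen_r_lah_row_eq_sum:
  assumes "n \<le> N"
  shows "gen_r_lah_row n r = (\<Sum>k\<le>N. gen_r_lah (int n) (int k) r)"
  unfolding gen_r_lah_row_def using assms
  by (intro sum.mono_neutral_left) (auto simp: gen_r_lah_eq_0)

theorem theorem2p6:
  fixes n r :: nat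
  defines "a \<equiv> indet_a" and "b \<equiv> indet_b"
  shows "gen_r_lah_row n (int r) =
           (\<Sum>i=0..n. of_nat (n choose i) * gen_r_lah_row (n - i) 0 *
              (\<Prod>j<i. a * of_nat j + (a + b) * of_nat r))
       \<and> gen_r_lah_row (n + 1) (int r) =
           of_nat r * (\<Sum>i=0..n. of_nat (n choose i) * gen_r_lah_row (n - i) (int r - 1) *
              (\<Prod>j=0..i. a * of_nat j + a + b))
         + (\<Sum>i=0..n. of_nat (n choose i) * gen_r_lah_row (n - i) (int r) *
              (\<Prod>j<i. a * of_nat j + a + b))"
proof
  have row0: "(\<Sum>k\<le>n. gen_r_lah (int (n - i)) (int k) 0) = gen_r_lah_row (n - i) 0" for i
    by (rule gen_r_lah_row_eq_sum[symmetric]) simp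
  show "gen_r_lah_row n (int r) =
      (\<Sum>i=0..n. of_nat (n choose i) * gen_r_lah_row (n - i) 0 *
        (\<Prod>j<i. a * of_nat j + (a + b) * of_nat r))"
    unfolding a_def b_def gen_r_lah_row_eq_sum[OF order.refl, of n] gen_r_lah_eq_conv
      sum_binomial_conv atLeast0AtMost row0 ..
  \<comment> \<open>The term \<open>k = 0\<close> has second argument \<open>-1\<close> and
    vanishes; the others are reindexed to \<open>k \<le> n\<close>.\<close>
  have shift: "(\<Sum>k\<le>Suc n. gen_r_lah (int (n - i)) (int k - 1) (int r)) =
      gen_r_lah_row (n - i) (int r)" for i
    by (subst sum.atMost_Suc_shift) (simp add: gen_r_lah_eq_0 gen_r_lah_row_eq_sum[of "n - i" n])
  have row: "(\<Sum>k\<le>Suc n. gen_r_lah (int (n - i)) (int k) (int r - 1)) =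
      gen_r_lah_row (n - i) (int r - 1)" for i
    by (rule gen_r_lah_row_eq_sum[symmetric]) simp
  show "gen_r_lah_row (n + 1) (int r) =
      of_nat r * (\<Sum>i=0..n. of_nat (n choose i) * gen_r_lah_row (n - i) (int r - 1) *
        (\<Prod>j=0..i. a * of_nat j + a + b))
      + (\<Sum>i=0..n. of_nat (n choose i) * gen_r_lah_row (n - i) (int r) *
        (\<Prod>j<i. a * of_nat j + a + b))"
    unfolding a_def b_def Suc_eq_plus1[symmetric] gen_r_lah_row_eq_sum[OF order.refl, of "Suc n"]
      gen_r_lah_Suc_eq_conv sum.distrib sum_distrib_left[symmetric] sum_binomial_conv
      atLeast0AtMost shift row ..
qed

end
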